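(* Let $(L,\prec)$ and $(M,\prec)$ be proximity frames. Let $\mathbf{PrFrm}(L;M)$ be the set of proximity homomorphisms $L\to M$, and let $\mathbf{C}(\mathfrak{R}L;M)$ be the set of frame homomorphisms $\psi:\mathfrak{R}L\to M$ such that $I\ll J$ in $\mathfrak{R}L$ implies $\psi(I)\prec\psi(J)$ in $M$. Consider the assignments $$\theta_{L,M}:\mathbf{PrFrm}(L;M)\to\mathbf{C}(\mathfrak{R}L;M),\quad f\mapsto \varsigma_M\circ\mathfrak{R}f,\qquad \rho_{L,M}:\mathbf{C}(\mathfrak{R}L;M)\to\mathbf{PrFrm}(L;M),\quad \varphi\mapsto\varphi\circ\kappa_L .$$ Then $\theta_{L,M}\circ\rho_{L,M}=1$ and $\rho_{L,M}\circ\theta_{L,M}=1$.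
   Context: A proximity on a frame $L$ is a binary relation $\prec$ on $L$ such that: (1) $a\prec b$ implies $a\le b$, and $\prec$ is a (bounded) sublattice of $L\times L$, i.e. $0\prec 0$, $1\prec 1$, and $a_1\prec b_1$, $a_2\prec b_2$ imply $a_1\wedge a_2\prec b_1\wedge b_2$ and $a_1\vee a_2\prec b_1\vee b_2$; (2) $a\le b\prec c\le d$ implies $a\prec d$; (3) $a\prec b$ implies $a\prec c\prec b$ for some $c$; (4) $a=\bigvee\{b\mid b\prec a\}$ for all $a\in L$. The pair $(L,\prec)$ is called a proximity frame. A proximity homomorphism $f:(L,\prec)\to(M,\prec)$ is a meet-semilattice homomorphism (preserving binary meets and the top $1$) such that: (1) $f(0)=0$; (2) $a_1\prec b_1$ and $a_2\prec b_2$ imply $f(a_1\vee a_2)\prec f(b_1)\vee f(b_2)$; (3) $f(a)=\bigvee\{f(b)\mid b\prec a\}$ for all $a$. An ideal of $L$ is a downset closed under finite joins (in particular it contains $0$). An ideal $I$ is round if for each $a\in I$ there is $b\in I$ with $a\prec b$. $\mathfrak{R}L$ is the set of round ideals of $L$ ordered by inclusion; it is a frame (a subframe of the frame of ideals of $L$), and $\ll$ denotes its way-below relation: $x\ll y$ iff whenever $y\le\bigvee S$ there is a finite $F\subseteq S$ with $x\le\bigvee F$. $\varsigma_L:\mathfrak{R}L\to L$ is $\varsigma_L(I)=\bigvee I$, and $\kappa_L:L\to\mathfrak{R}L$ is $\kappa_L(a)=\{b\mid b\prec a\}$. For a meet-semilattice homomorphism $f:L\to M$ between proximity frames, $\mathfrak{R}f:\mathfrak{R}L\to\mathfrak{R}M$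 is $\mathfrak{R}f(I)=\{a\in M\mid a\prec f(b)\text{ for some }b\in I\}$. *)

theory Defs
  imports Main "HOL-Library.FuncSet"
begin

unbundle lattice_syntax

section \<open>Frames\<close>

text \<open>The library class \<^class>\<open>complete_distrib_lattice\<close> demands complete distributivity, which is
  stronger than the frame law.\<close>

class frame = complete_lattice +
  assumes inf_Sup_frame: "a \<sqinter> \<Squnion>S = \<Squnion>((\<lambda>s. a \<sqinter> s) ` S)"

definition way_below :: "'a::complete_lattice \<Rightarrow> 'a \<Rightarrow> bool" (infix \<open>\<lless>\<close> 50)
  where "x \<lless> y \<longleftrightarrow> (\<forall>S. y \<le> \<Squnion>S \<longrightarrow> (\<exists>F. finite F \<and> F \<subseteq> S \<and> x \<le> \<Squnion>F))"

definition frame_hom :: "('a::frame \<Rightarrow> 'b::frame) \<Rightarrow> bool"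
  where "frame_hom \<psi> \<longleftrightarrow>
    \<psi> \<top> = \<top> \<and> (\<forall>x y. \<psi> (x \<sqinter> y) = \<psi> x \<sqinter> \<psi> y) \<and> (\<forall>S. \<psi> (\<Squnion>S) = \<Squnion>(\<psi> ` S))"

definition meet_semilattice_hom :: "('a::bounded_lattice \<Rightarrow> 'b::bounded_lattice) \<Rightarrow> bool"
  where "meet_semilattice_hom f \<longleftrightarrow> f \<top> = \<top> \<and> (\<forall>x y. f (x \<sqinter> y) = f x \<sqinter> f y)"

lemma meet_semilattice_hom_mono:
  assumes "meet_semilattice_hom f" "x \<le> y" shows "f x \<le> f y"
  using assms unfolding meet_semilattice_hom_def by (metis inf.orderE inf.cobounded2)


section \<open>Proximity frames\<close>

class proximity_frame = frame +
  fixes prox :: "'a \<Rightarrow> 'a \<Rightarrow> bool" (infix \<open>\<prec>\<close> 50)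
  assumes prox_le: "a \<prec> b \<Longrightarrow> a \<le> b"
    and prox_bot: "\<bottom> \<prec> \<bottom>"
    and prox_top: "\<top> \<prec> \<top>"
    and prox_inf: "a\<^sub>1 \<prec> b\<^sub>1 \<Longrightarrow> a\<^sub>2 \<prec> b\<^sub>2 \<Longrightarrow> a\<^sub>1 \<sqinter> a\<^sub>2 \<prec> b\<^sub>1 \<sqinter> b\<^sub>2"
    and prox_sup: "a\<^sub>1 \<prec> b\<^sub>1 \<Longrightarrow> a\<^sub>2 \<prec> b\<^sub>2 \<Longrightarrow> a\<^sub>1 \<squnion> a\<^sub>2 \<prec> b\<^sub>1 \<squnion> b\<^sub>2"
    and prox_trans: "a \<le> b \<Longrightarrow> b \<prec> c \<Longrightarrow> c \<le> d \<Longrightarrow> a \<prec> d"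
    and prox_interpolate: "a \<prec> b \<Longrightarrow> \<exists>c. a \<prec> c \<and> c \<prec> b"
    and prox_approx: "a = \<Squnion>{b. b \<prec> a}"

lemma prox_down: "a \<le> b \<Longrightarrow> b \<prec> c \<Longrightarrow> a \<prec> c"
  and prox_up: "a \<prec> b \<Longrightarrow> b \<le> c \<Longrightarrow> a \<prec> c"
  and bot_prox: "\<bottom> \<prec> a"
  and prox_to_top: "a \<prec> \<top>"
  for a b c :: "'a::proximity_frame"
  by (auto intro: prox_trans prox_trans[OF _ prox_bot] prox_trans[OF _ prox_top])

definition proximity_hom :: "('a::proximity_frame \<Rightarrow> 'b::proximity_frame) \<Rightarrow> bool"
  where "proximity_hom f \<longleftrightarrow>
    meet_semilattice_hom f \<and>
    f \<bottom> = \<bottom> \<and>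
    (\<forall>a\<^sub>1 b\<^sub>1 a\<^sub>2 b\<^sub>2. a\<^sub>1 \<prec> b\<^sub>1 \<longrightarrow> a\<^sub>2 \<prec> b\<^sub>2 \<longrightarrow> f (a\<^sub>1 \<squnion> a\<^sub>2) \<prec> f b\<^sub>1 \<squnion> f b\<^sub>2) \<and>
    (\<forall>a. f a = \<Squnion>{f b | b. b \<prec> a})"


section \<open>The frame of round ideals\<close>

definition is_ideal :: "'a::bounded_lattice set \<Rightarrow> bool"
  where "is_ideal I \<longleftrightarrow>
    (\<forall>a\<in>I. \<forall>b. b \<le> a \<longrightarrow> b \<in> I) \<and> \<bottom> \<in> I \<and> (\<forall>a\<in>I. \<forall>b\<in>I. a \<squnion> b \<in> I)"

lemma is_idealI:
  assumes "\<And>a b. a \<in> I \<Longrightarrow> b \<in> I \<Longrightarrow> a \<squnion> b \<in> I" and "\<bottom> \<in> I"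
    and "\<And>a b. a \<in> I \<Longrightarrow> b \<le> a \<Longrightarrow> b \<in> I"
  shows "is_ideal I"
  using assms by (simp add: is_ideal_def)

definition is_round :: "'a::proximity_frame set \<Rightarrow> bool"
  where "is_round I \<longleftrightarrow> (\<forall>a\<in>I. \<exists>b\<in>I. a \<prec> b)"

typedef (overloaded) 'a round_ideal = "{I :: 'a::proximity_frame set. is_ideal I \<and> is_round I}"
  morphisms elts Abs_round_ideal
proof
  show "{\<bottom>} \<in> {I :: 'a set. is_ideal I \<and> is_round I}"
    by (auto simp: is_ideal_def is_round_def prox_bot bot_unique)
qed

lemma elts_bot: "\<bottom> \<in> elts I"
  and elts_down: "a \<in> elts I \<Longrightarrow> b \<le> a \<Longrightarrow> b \<in> elts I"
  and elts_sup: "a \<in> elts I \<Longrightarrow> b \<in> elts I \<Longrightarrow> a \<squnion> b \<in> elts I"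
  and elts_round: "a \<in> elts I \<Longrightarrow> \<exists>b\<in>elts I. a \<prec> b"
  using elts[of I] by (auto simp: is_ideal_def is_round_def)

lemma elts_Sup: "finite F \<Longrightarrow> F \<subseteq> elts I \<Longrightarrow> \<Squnion>F \<in> elts I"
  by (induction F rule: finite_induct) (auto simp: elts_bot elts_sup)

lemma elts_Abs: "is_ideal I \<Longrightarrow> is_round I \<Longrightarrow> elts (Abs_round_ideal I) = I"
  by (simp add: Abs_round_ideal_inverse)

lemma prox_Sup:
  "finite F \<Longrightarrow> (\<And>x. x \<in> F \<Longrightarrow> x \<prec> g x) \<Longrightarrow> \<Squnion>F \<prec> \<Squnion>(g ` F)"
  by (induction F rule: finite_induct) (auto simp: prox_bot intro: prox_sup)

text \<open>The order is inclusion. The remaining lattice operations are determined by the order through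
  the class axioms.\<close>

instantiation round_ideal :: (proximity_frame) complete_lattice
begin

definition less_eq_round_ideal :: "'a round_ideal \<Rightarrow> 'a round_ideal \<Rightarrow> bool"
  where "I \<le> J \<longleftrightarrow> elts I \<subseteq> elts J"

definition less_round_ideal :: "'a round_ideal \<Rightarrow> 'a round_ideal \<Rightarrow> bool"
  where "I < J \<longleftrightarrow> elts I \<subset> elts J"

definition bot_round_ideal :: "'a round_ideal"
  where "\<bottom> = Abs_round_ideal {\<bottom>}"

definition top_round_ideal :: "'a round_ideal"
  where "\<top> = Abs_round_ideal UNIV"

definition inf_round_ideal :: "'a round_ideal \<Rightarrow> 'a round_ideal \<Rightarrow> 'a round_ideal"
  where "I \<sqinter> J = Abs_round_ideal (elts I \<inter> elts J)"

definition sup_round_ideal :: "'a round_ideal \<Rightarrow> 'a round_ideal \<Rightarrow> 'a round_ideal"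
  where "I \<squnion> J = Abs_round_ideal {a. \<exists>b\<in>elts I. \<exists>c\<in>elts J. a \<le> b \<squnion> c}"

definition Inf_round_ideal :: "'a round_ideal set \<Rightarrow> 'a round_ideal"
  where "\<Sqinter>\<I> = Abs_round_ideal {a. \<exists>b \<in> (\<Inter>I\<in>\<I>. elts I). a \<prec> b}"

definition Sup_round_ideal :: "'a round_ideal set \<Rightarrow> 'a round_ideal"
  where "\<Squnion>\<I> = Abs_round_ideal {a. \<exists>F. finite F \<and> F \<subseteq> (\<Union>I\<in>\<I>. elts I) \<and> a \<le> \<Squnion>F}"

lemma elts_bot_eq: "elts (\<bottom> :: 'a round_ideal) = {\<bottom>}"
  unfolding bot_round_ideal_def
  by (rule elts_Abs) (auto simp: is_ideal_def is_round_def prox_bot bot_unique)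

lemma elts_top_eq: "elts (\<top> :: 'a round_ideal) = UNIV"
  unfolding top_round_ideal_def
  by (rule elts_Abs) (auto simp: is_ideal_def is_round_def intro: prox_to_top)

lemma elts_inf_eq: "elts (I \<sqinter> J :: 'a round_ideal) = elts I \<inter> elts J"
  unfolding inf_round_ideal_def
proof (rule elts_Abs)
  show "is_ideal (elts I \<inter> elts J)"
    by (auto simp: is_ideal_def elts_bot elts_sup intro: elts_down)
  show "is_round (elts I \<inter> elts J)"
    unfolding is_round_def
  proof
    fix a assume "a \<in> elts I \<inter> elts J"
    then obtain b c where *: "b \<in> elts I" "a \<prec> b" "c \<in> elts J" "a \<prec> c"
      using elts_round by blast
    then have "a \<prec> b \<sqinter> c" using prox_inf[of a b a c] by simp
    moreover have "b \<sqinter> c \<in> elts I \<inter> elts J"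
      using * by (auto intro: elts_down)
    ultimately show "\<exists>b\<in>elts I \<inter> elts J. a \<prec> b" by blast
  qed
qed

lemma elts_sup_eq: "elts (I \<squnion> J :: 'a round_ideal) = {a. \<exists>b\<in>elts I. \<exists>c\<in>elts J. a \<le> b \<squnion> c}"
    (is "_ = ?K")
  unfolding sup_round_ideal_def
proof (rule elts_Abs)
  have "x \<squnion> y \<in> ?K" if xy: "x \<in> ?K" "y \<in> ?K" for x y
  proof -
    obtain b c b' c' where *: "b \<in> elts I" "c \<in> elts J" "x \<le> b \<squnion> c"
      "b' \<in> elts I" "c' \<in> elts J" "y \<le> b' \<squnion> c'"
      using xy by blast
    then have "x \<squnion> y \<le> (b \<squnion> b') \<squnion> (c \<squnion> c')"
      by (metis sup.mono sup_assoc sup_left_commute)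
    then show ?thesis using * elts_sup by blast
  qed
  moreover have "\<bottom> \<in> ?K" using elts_bot by auto
  moreover have "y \<in> ?K" if "x \<in> ?K" "y \<le> x" for x y
    using that(1) order_trans[OF that(2)] by blast
  ultimately show "is_ideal ?K" by (rule is_idealI)
  show "is_round ?K"
    unfolding is_round_def
  proof
    fix a assume "a \<in> ?K"
    then obtain b c where *: "b \<in> elts I" "c \<in> elts J" "a \<le> b \<squnion> c" by blast
    obtain b' c' where **: "b' \<in> elts I" "b \<prec> b'" "c' \<in> elts J" "c \<prec> c'"
      using elts_round * by blast
    have "a \<prec> b' \<squnion> c'" using prox_down[OF *(3) prox_sup[OF **(2,4)]] .
    then show "\<exists>b\<in>?K. a \<prec> b" using ** by blast
  qed
qed

lemma elts_Inf_eq: "elts (\<Sqinter>\<I> :: 'a round_ideal) = {a. \<exists>b \<in> (\<Inter>I\<in>\<I>. elts I). a \<prec> b}"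
    (is "_ = ?K")
  unfolding Inf_round_ideal_def
proof (rule elts_Abs)
  have "x \<squnion> y \<in> ?K" if xy: "x \<in> ?K" "y \<in> ?K" for x y
  proof -
    obtain b c where *: "b \<in> (\<Inter>I\<in>\<I>. elts I)" "x \<prec> b" "c \<in> (\<Inter>I\<in>\<I>. elts I)" "y \<prec> c"
      using xy by blast
    have "b \<squnion> c \<in> (\<Inter>I\<in>\<I>. elts I)" using * elts_sup by blast
    then show ?thesis using prox_sup[OF *(2,4)] by blast
  qed
  moreover have "\<bottom> \<in> ?K" using elts_bot prox_bot by blast
  moreover have "y \<in> ?K" if "x \<in> ?K" "y \<le> x" for x y
    using that(1) prox_down[OF that(2)] by blast
  ultimately show "is_ideal ?K" by (rule is_idealI)
  show "is_round ?K"
    unfolding is_round_def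
  proof
    fix a assume "a \<in> ?K"
    then obtain b where "b \<in> (\<Inter>I\<in>\<I>. elts I)" "a \<prec> b" by blast
    moreover obtain c where "a \<prec> c" "c \<prec> b" using prox_interpolate[OF \<open>a \<prec> b\<close>] by blast
    ultimately show "\<exists>c\<in>?K. a \<prec> c" by blast
  qed
qed

lemma elts_Sup_eq:
  "elts (\<Squnion>\<I> :: 'a round_ideal) = {a. \<exists>F. finite F \<and> F \<subseteq> (\<Union>I\<in>\<I>. elts I) \<and> a \<le> \<Squnion>F}"
    (is "_ = ?K")
  unfolding Sup_round_ideal_def
proof (rule elts_Abs)
  have "x \<squnion> y \<in> ?K" if xy: "x \<in> ?K" "y \<in> ?K" for x y
  proof -
    obtain F G where *: "finite F" "F \<subseteq> (\<Union>I\<in>\<I>. elts I)" "x \<le> \<Squnion>F"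
      "finite G" "G \<subseteq> (\<Union>I\<in>\<I>. elts I)" "y \<le> \<Squnion>G"
      using xy by blast
    then have "x \<squnion> y \<le> \<Squnion>(F \<union> G)" by (simp add: Sup_union_distrib le_supI1 le_supI2)
    then show ?thesis using * by (blast intro: finite_UnI)
  qed
  moreover have "\<bottom> \<in> ?K" by (auto intro: exI[of _ "{}"])
  moreover have "y \<in> ?K" if "x \<in> ?K" "y \<le> x" for x y
    using that(1) order_trans[OF that(2)] by blast
  ultimately show "is_ideal ?K" by (rule is_idealI)
  show "is_round ?K"
    unfolding is_round_def
  proof
    fix a assume "a \<in> ?K"
    then obtain F where F: "finite F" "F \<subseteq> (\<Union>I\<in>\<I>. elts I)" "a \<le> \<Squnion>F" by blast
    have "\<forall>x\<in>F. \<exists>y. y \<in> (\<Union>I\<in>\<I>. elts I) \<and> x \<prec> y"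
      using F(2) elts_round by blast
    then obtain g where g: "\<forall>x\<in>F. g x \<in> (\<Union>I\<in>\<I>. elts I) \<and> x \<prec> g x" by metis
    have "a \<prec> \<Squnion>(g ` F)"
      by (rule prox_down[OF F(3) prox_Sup]) (use F(1) g in auto)
    moreover have "\<Squnion>(g ` F) \<in> ?K" using F(1) g by (blast intro: finite_imageI)
    ultimately show "\<exists>b\<in>?K. a \<prec> b" by blast
  qed
qed

instance
proof
  fix I J K :: "'a round_ideal" and \<I> :: "'a round_ideal set"
  show "(I < J) = (I \<le> J \<and> \<not> J \<le> I)"
    by (auto simp: less_eq_round_ideal_def less_round_ideal_def)
  show "I \<le> I" by (simp add: less_eq_round_ideal_def)
  show "I \<le> J \<Longrightarrow> J \<le> K \<Longrightarrow> I \<le> K" by (auto simp: less_eq_round_ideal_def)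
  show "I \<le> J \<Longrightarrow> J \<le> I \<Longrightarrow> I = J"
    by (simp add: less_eq_round_ideal_def elts_inject[symmetric])
  show "I \<sqinter> J \<le> I" "I \<sqinter> J \<le> J" by (auto simp: less_eq_round_ideal_def elts_inf_eq)
  show "I \<le> J \<Longrightarrow> I \<le> K \<Longrightarrow> I \<le> J \<sqinter> K" by (auto simp: less_eq_round_ideal_def elts_inf_eq)
  show "I \<le> I \<squnion> J"
    unfolding less_eq_round_ideal_def elts_sup_eq using elts_bot[of J] by (auto intro: le_supI1)
  show "J \<le> I \<squnion> J"
    unfolding less_eq_round_ideal_def elts_sup_eq using elts_bot[of I] by (auto intro: le_supI2)
  show "J \<le> I \<Longrightarrow> K \<le> I \<Longrightarrow> J \<squnion> K \<le> I"
    unfolding less_eq_round_ideal_def elts_sup_eq using elts_down[of _ I] elts_sup[of _ I] by blast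
  show "I \<in> \<I> \<Longrightarrow> \<Sqinter>\<I> \<le> I"
    unfolding less_eq_round_ideal_def elts_Inf_eq by (auto intro: elts_down prox_le)
  show "I \<le> \<Sqinter>\<I>" if "\<And>J. J \<in> \<I> \<Longrightarrow> I \<le> J"
    using that elts_round[of _ I] unfolding less_eq_round_ideal_def elts_Inf_eq by blast
  show "I \<le> \<Squnion>\<I>" if "I \<in> \<I>"
  proof -
    have "finite {a} \<and> {a} \<subseteq> (\<Union>I\<in>\<I>. elts I) \<and> a \<le> \<Squnion>{a}" if "a \<in> elts I" for a
      using that \<open>I \<in> \<I>\<close> by auto
    then show ?thesis unfolding less_eq_round_ideal_def elts_Sup_eq by blast
  qed
  show "\<Squnion>\<I> \<le> I" if "\<And>J. J \<in> \<I> \<Longrightarrow> J \<le> I"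
    unfolding less_eq_round_ideal_def
  proof
    fix a assume "a \<in> elts (\<Squnion>\<I>)"
    then obtain F where F: "finite F" "F \<subseteq> (\<Union>I\<in>\<I>. elts I)" "a \<le> \<Squnion>F"
      unfolding elts_Sup_eq by blast
    have "F \<subseteq> elts I" using F(2) that unfolding less_eq_round_ideal_def by blast
    then show "a \<in> elts I" using elts_down[OF elts_Sup[OF F(1)] F(3)] by simp
  qed
  show "\<Sqinter>{} = (\<top> :: 'a round_ideal)"
    unfolding elts_inject[symmetric] elts_Inf_eq elts_top_eq
    by (auto intro: prox_to_top)
  show "\<Squnion>{} = (\<bottom> :: 'a round_ideal)"
    unfolding elts_inject[symmetric] elts_Sup_eq elts_bot_eq by (auto simp: bot_unique)
qed

end

instance round_ideal :: (proximity_frame) frame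
proof
  fix I :: "'a round_ideal" and \<I> :: "'a round_ideal set"
  show "I \<sqinter> \<Squnion>\<I> = \<Squnion>((\<lambda>J. I \<sqinter> J) ` \<I>)"
  proof (rule order.antisym)
    show "I \<sqinter> \<Squnion>\<I> \<le> \<Squnion>((\<lambda>J. I \<sqinter> J) ` \<I>)"
      unfolding less_eq_round_ideal_def
    proof
      fix a assume "a \<in> elts (I \<sqinter> \<Squnion>\<I>)"
      then obtain F where F: "a \<in> elts I" "finite F" "F \<subseteq> (\<Union>I\<in>\<I>. elts I)" "a \<le> \<Squnion>F"
        unfolding elts_inf_eq elts_Sup_eq by blast
      let ?G = "(\<lambda>s. a \<sqinter> s) ` F"
      have "a = a \<sqinter> \<Squnion>F" using F(4) by (simp add: inf.absorb1)
      then have "a = \<Squnion>?G" by (simp only: inf_Sup_frame)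
      then have "a \<le> \<Squnion>?G" by simp
      moreover have "?G \<subseteq> (\<Union>J\<in>(\<lambda>J. I \<sqinter> J) ` \<I>. elts J)"
        using F(1,3) elts_down[OF _ inf_le1] elts_down[OF _ inf_le2] by (fastforce simp: elts_inf_eq)
      ultimately show "a \<in> elts (\<Squnion>((\<lambda>J. I \<sqinter> J) ` \<I>))"
        using F(2) unfolding elts_Sup_eq by blast
    qed
    show "\<Squnion>((\<lambda>J. I \<sqinter> J) ` \<I>) \<le> I \<sqinter> \<Squnion>\<I>"
      by (auto intro!: Sup_least intro: le_infI2 Sup_upper)
  qed
qed


section \<open>The maps between \<open>L\<close> and its frame of round ideals\<close>

definition varsigma :: "'a::proximity_frame round_ideal \<Rightarrow> 'a" (\<open>\<varsigma>\<close>)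
  where "\<varsigma> I = \<Squnion>(elts I)"

definition kappa :: "'a::proximity_frame \<Rightarrow> 'a round_ideal" (\<open>\<kappa>\<close>)
  where "\<kappa> a = Abs_round_ideal {b. b \<prec> a}"

text \<open>Meaningful for meet-semilattice homomorphisms \<open>f\<close>; see \<open>elts_round_map\<close> below.\<close>

definition round_map ::
    "('a::proximity_frame \<Rightarrow> 'b::proximity_frame) \<Rightarrow> 'a round_ideal \<Rightarrow> 'b round_ideal" (\<open>\<RR>\<close>)
  where "\<RR> f I = Abs_round_ideal {a. \<exists>b\<in>elts I. a \<prec> f b}"

lemma elts_kappa: "elts (\<kappa> a) = {b. b \<prec> a}"
  unfolding kappa_def
proof (rule elts_Abs)
  have "x \<squnion> y \<prec> a" if "x \<prec> a" "y \<prec> a" for x y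
    using prox_sup[OF that] by simp
  moreover have "\<bottom> \<prec> a" by (rule bot_prox)
  moreover have "y \<prec> a" if "x \<prec> a" "y \<le> x" for x y
    using prox_down[OF that(2,1)] .
  ultimately show "is_ideal {b. b \<prec> a}" unfolding is_ideal_def by blast
  show "is_round {b. b \<prec> a}" unfolding is_round_def using prox_interpolate by blast
qed

lemma elts_round_map:
  assumes "meet_semilattice_hom f"
  shows "elts (\<RR> f I) = {a. \<exists>b\<in>elts I. a \<prec> f b}" (is "_ = ?K")
  unfolding round_map_def
proof (rule elts_Abs)
  have "x \<squnion> y \<in> ?K" if xy: "x \<in> ?K" "y \<in> ?K" for x y
  proof -
    obtain b c where *: "b \<in> elts I" "x \<prec> f b" "c \<in> elts I" "y \<prec> f c"
      using xy by blast
    have "f b \<squnion> f c \<le> f (b \<squnion> c)"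
      using meet_semilattice_hom_mono[OF assms] by simp
    then have "x \<squnion> y \<prec> f (b \<squnion> c)"
      using prox_up[OF prox_sup[OF *(2,4)]] by simp
    then show ?thesis using * elts_sup by blast
  qed
  moreover have "\<bottom> \<in> ?K"
    using elts_bot bot_prox by auto
  moreover have "y \<in> ?K" if "x \<in> ?K" "y \<le> x" for x y
    using that(1) prox_down[OF that(2)] by blast
  ultimately show "is_ideal ?K" by (rule is_idealI)
  show "is_round ?K" unfolding is_round_def using prox_interpolate by blast
qed

definition PrFrm :: "('a::proximity_frame \<Rightarrow> 'b::proximity_frame) set"
  where "PrFrm = {f. proximity_hom f}"

definition C_hom :: "('a::proximity_frame round_ideal \<Rightarrow> 'b::proximity_frame) set"
  where "C_hom = {\<psi>. frame_hom \<psi> \<and> (\<forall>I J. I \<lless> J \<longrightarrow> \<psi> I \<prec> \<psi> J)}"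

definition theta ::
    "('a::proximity_frame \<Rightarrow> 'b::proximity_frame) \<Rightarrow> ('a round_ideal \<Rightarrow> 'b)" (\<open>\<theta>\<close>)
  where "\<theta> f = \<varsigma> \<circ> \<RR> f"

definition rho ::
    "('a::proximity_frame round_ideal \<Rightarrow> 'b::proximity_frame) \<Rightarrow> ('a \<Rightarrow> 'b)" (\<open>\<rho>\<close>)
  where "\<rho> \<phi> = \<phi> \<circ> \<kappa>"

end

theory Submission
  imports Defs
begin

text \<open>Every round ideal \<open>J\<close> is the directed join of the \<open>\<kappa> b\<close> with \<open>b \<in> J\<close>, so \<open>I \<lless> J\<close> holds
  iff \<open>I \<le> \<kappa> b\<close> for some \<open>b \<in> J\<close>. On the other side, \<open>\<theta> f I\<close> is just \<open>\<Squnion>(f ` I)\<close>. Both composites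
  are then the identity because a frame homomorphism preserves the join of the \<open>\<kappa> b\<close> and a
  proximity homomorphism satisfies \<open>f a = \<Squnion>{f b | b. b \<prec> a}\<close>.\<close>

text \<open>Roundness gives the inclusion of \<open>I\<close> in the join: each \<open>a\<close> in
  \<open>I\<close> has some \<open>b\<close> in \<open>I\<close> with \<open>a \<prec> b\<close>,
  which puts \<open>a\<close> into \<open>\<kappa> b\<close>.\<close>

lemma round_ideal_eq_Sup_kappa: "(I :: 'a::proximity_frame round_ideal) = \<Squnion>(\<kappa> ` elts I)"
proof (rule order.antisym)
  show "I \<le> \<Squnion>(\<kappa> ` elts I)"
    unfolding less_eq_round_ideal_def
  proof
    fix a assume "a \<in> elts I"
    then obtain b where b: "b \<in> elts I" "a \<prec> b" using elts_round by blast
    have "\<kappa> b \<le> \<Squnion>(\<kappa> ` elts I)" using b(1) by (auto intro: Sup_upper)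
    then show "a \<in> elts (\<Squnion>(\<kappa> ` elts I))"
      using b(2) by (auto simp: less_eq_round_ideal_def elts_kappa)
  qed
  show "\<Squnion>(\<kappa> ` elts I) \<le> I"
    by (rule SUP_least) (auto simp: less_eq_round_ideal_def elts_kappa dest: prox_le elts_down)
qed

lemma kappa_mono: "a \<le> b \<Longrightarrow> \<kappa> a \<le> \<kappa> b"
  by (auto simp: less_eq_round_ideal_def elts_kappa intro: prox_up)

lemma kappa_top: "\<kappa> \<top> = \<top>"
  by (simp add: elts_inject[symmetric] elts_kappa elts_top_eq prox_to_top)

lemma kappa_bot: "\<kappa> \<bottom> = \<bottom>"
  unfolding elts_inject[symmetric] elts_kappa elts_bot_eq
  using prox_bot prox_le bot_unique by blast

lemma kappa_inf: "\<kappa> (a \<sqinter> b) = \<kappa> a \<sqinter> \<kappa> b"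
proof -
  have "x \<prec> a \<sqinter> b" if "x \<prec> a" "x \<prec> b" for x
    using prox_inf[OF that] by simp
  then show ?thesis
    unfolding elts_inject[symmetric] elts_kappa elts_inf_eq by (auto intro: prox_up)
qed

text \<open>From left to right, the cover of \<open>J\<close> by the ideals
  \<open>\<kappa> b\<close> has a finite subcover, and its indices are merged into their join, which
  stays in \<open>J\<close>. Conversely, membership of \<open>b\<close> in a join of round ideals is
  witnessed by finitely many elements, hence by finitely many of the ideals, so these already cover
  \<open>\<kappa> b\<close>.\<close>

lemma way_below_round_ideal_iff:
  "I \<lless> J \<longleftrightarrow> (\<exists>b\<in>elts J. I \<le> \<kappa> b)" for I J :: "'a::proximity_frame round_ideal"
proof
  assume "I \<lless> J"
  then have "\<exists>F. finite F \<and> F \<subseteq> \<kappa> ` elts J \<and> I \<le> \<Squnion>F"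
    unfolding way_below_def using round_ideal_eq_Sup_kappa[of J] by (metis order_refl)
  then obtain G where G: "finite G" "G \<subseteq> elts J" "I \<le> \<Squnion>(\<kappa> ` G)"
    by (metis finite_subset_image)
  have "\<Squnion>(\<kappa> ` G) \<le> \<kappa> (\<Squnion>G)"
    by (auto intro!: SUP_least kappa_mono Sup_upper)
  then have "I \<le> \<kappa> (\<Squnion>G)" using G(3) by (rule order_trans[rotated])
  then show "\<exists>b\<in>elts J. I \<le> \<kappa> b" using elts_Sup[OF G(1,2)] by blast
next
  assume "\<exists>b\<in>elts J. I \<le> \<kappa> b"
  then obtain b where b: "b \<in> elts J" "I \<le> \<kappa> b" by blast
  show "I \<lless> J"
    unfolding way_below_def
  proof (intro allI impI)
    fix S assume "J \<le> \<Squnion>S"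
    then have "b \<in> elts (\<Squnion>S)" using b(1) by (auto simp: less_eq_round_ideal_def)
    then obtain F where F: "finite F" "F \<subseteq> (\<Union>K\<in>S. elts K)" "b \<le> \<Squnion>F"
      unfolding elts_Sup_eq by blast
    obtain T where T: "finite T" "T \<subseteq> S" "F \<subseteq> (\<Union>K\<in>T. elts K)"
      using finite_subset_Union[OF F(1), of "elts ` S"] F(2)
      by (metis finite_subset_image)
    have "b \<in> elts (\<Squnion>T)" unfolding elts_Sup_eq using F(1,3) T(3) by blast
    then have "\<kappa> b \<le> \<Squnion>T"
      by (auto simp: less_eq_round_ideal_def elts_kappa intro: elts_down prox_le)
    then show "\<exists>F. finite F \<and> F \<subseteq> S \<and> I \<le> \<Squnion>F"
      using T(1,2) order_trans[OF b(2)] by blast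
  qed
qed

text \<open>The elements proximal to \<open>f b\<close> join to \<open>f b\<close> by
  \<open>prox_approx\<close> in the codomain, so rounding off the image does not change its
  join.\<close>

lemma theta_eq:
  fixes f :: "'a::proximity_frame \<Rightarrow> 'b::proximity_frame"
  assumes "meet_semilattice_hom f"
  shows "\<theta> f I = \<Squnion>(f ` elts I)"
proof -
  have "\<theta> f I = \<Squnion>{a. \<exists>b\<in>elts I. a \<prec> f b}"
    by (simp add: theta_def varsigma_def elts_round_map[OF assms])
  also have "\<dots> = \<Squnion>(f ` elts I)"
  proof (rule order.antisym)
    show "\<Squnion>{a. \<exists>b\<in>elts I. a \<prec> f b} \<le> \<Squnion>(f ` elts I)"
      by (rule Sup_least) (blast intro: SUP_upper2 prox_le)
    show "\<Squnion>(f ` elts I) \<le> \<Squnion>{a. \<exists>b\<in>elts I. a \<prec> f b}"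
    proof (rule SUP_least)
      fix b assume "b \<in> elts I"
      then have "\<Squnion>{a. a \<prec> f b} \<le> \<Squnion>{a. \<exists>b\<in>elts I. a \<prec> f b}"
        by (intro Sup_subset_mono) blast
      then show "f b \<le> \<Squnion>{a. \<exists>b\<in>elts I. a \<prec> f b}"
        by (simp only: prox_approx[of "f b", symmetric])
    qed
  qed
  finally show ?thesis .
qed

lemma proximity_homD:
  assumes "proximity_hom f"
  shows proximity_hom_meet: "meet_semilattice_hom f"
    and proximity_hom_bot: "f \<bottom> = \<bottom>"
    and proximity_hom_prox_sup:
      "a\<^sub>1 \<prec> b\<^sub>1 \<Longrightarrow> a\<^sub>2 \<prec> b\<^sub>2 \<Longrightarrow> f (a\<^sub>1 \<squnion> a\<^sub>2) \<prec> f b\<^sub>1 \<squnion> f b\<^sub>2"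
    and proximity_hom_approx: "f a = \<Squnion>{f b | b. b \<prec> a}"
  using assms unfolding proximity_hom_def by blast+

lemma proximity_hom_prox:
  assumes "proximity_hom f" "a \<prec> b"
  shows "f a \<prec> f b"
  using proximity_hom_prox_sup[OF assms(1) assms(2) assms(2)] by simp

text \<open>A proximity homomorphism need not preserve finite joins. This is the finitary form of
  condition (2) that replaces it: the inequality holds once every joinand is enlarged along
  \<open>\<prec>\<close>.\<close>

lemma proximity_hom_Sup_le:
  assumes f: "proximity_hom f" and "finite F" "\<And>x. x \<in> F \<Longrightarrow> k x \<prec> g x"
  shows "f (\<Squnion>(k ` F)) \<le> \<Squnion>((\<lambda>x. f (g x)) ` F)"
  using assms(2,3)
\<comment> \<open>\<open>k\<close> is generalised because the induction hypothesis is applied to the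
  interpolants \<open>h\<close> in its place.\<close>
proof (induction F arbitrary: k rule: finite_induct)
  case empty
  then show ?case by (simp add: proximity_hom_bot[OF f])
next
  case (insert x F)
  \<comment> \<open>Condition (2) raises the second joinand, so room for this is made by interpolation.\<close>
  obtain h where h: "\<And>y. y \<in> F \<Longrightarrow> k y \<prec> h y" "\<And>y. y \<in> F \<Longrightarrow> h y \<prec> g y"
  proof -
    have "\<forall>y\<in>F. \<exists>z. k y \<prec> z \<and> z \<prec> g y"
      using insert.prems prox_interpolate by blast
    then show ?thesis using that by metis
  qed
  have "\<Squnion>(k ` F) \<prec> \<Squnion>(h ` F)"
    using insert.hyps(1) h(1) by (induction F rule: finite_induct) (auto simp: prox_bot intro: prox_sup)
  then have "f (k x \<squnion> \<Squnion>(k ` F)) \<le> f (g x) \<squnion> f (\<Squnion>(h ` F))"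
    using insert.prems by (intro prox_le proximity_hom_prox_sup[OF f]) auto
  also have "\<dots> \<le> f (g x) \<squnion> \<Squnion>((\<lambda>x. f (g x)) ` F)"
    using insert.IH[OF h(2)] by (intro sup_mono order_refl)
  finally show ?case by simp
qed

text \<open>Joins are preserved although \<open>f\<close> itself may fail to preserve them, because
  the enlargement in \<open>proximity_hom_Sup_le\<close> can be carried out inside round
  ideals.\<close>

lemma frame_hom_theta:
  fixes f :: "'a::proximity_frame \<Rightarrow> 'b::proximity_frame"
  assumes f: "proximity_hom f"
  shows "frame_hom (\<theta> f)"
proof -
  note m = proximity_hom_meet[OF f]
  have mono: "f a \<le> f b" if "a \<le> b" for a b
    using meet_semilattice_hom_mono[OF m that] .
  have theta_mono: "\<theta> f I \<le> \<theta> f J" if "I \<le> J" for I J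
    using that unfolding theta_eq[OF m] less_eq_round_ideal_def by (intro Sup_subset_mono image_mono)
  have "f \<top> \<le> \<Squnion>(range f)" by (rule SUP_upper) simp
  then have top: "\<theta> f \<top> = \<top>"
    using m by (simp add: theta_eq[OF m] elts_top_eq meet_semilattice_hom_def top_unique)
  have inf: "\<theta> f (I \<sqinter> J) = \<theta> f I \<sqinter> \<theta> f J" for I J
  proof (rule order.antisym)
    show "\<theta> f (I \<sqinter> J) \<le> \<theta> f I \<sqinter> \<theta> f J" by (simp add: theta_mono)
    \<comment> \<open>By the frame law, used once for each factor, the meet of the two joins reduces
      to these binary meets.\<close>
    have "f a \<sqinter> f b \<le> \<theta> f (I \<sqinter> J)" if "a \<in> elts I" "b \<in> elts J" for a b
    proof -
      have "a \<sqinter> b \<in> elts (I \<sqinter> J)" using that by (auto simp: elts_inf_eq intro: elts_down)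
      then have "f (a \<sqinter> b) \<le> \<theta> f (I \<sqinter> J)" unfolding theta_eq[OF m] by (rule SUP_upper)
      then show ?thesis using m by (simp add: meet_semilattice_hom_def)
    qed
    then have "f b \<sqinter> \<theta> f I \<le> \<theta> f (I \<sqinter> J)" if "b \<in> elts J" for b
      using that unfolding theta_eq[OF m, of I] inf_Sup_frame
      by (auto intro!: SUP_least simp: inf_commute)
    then show "\<theta> f I \<sqinter> \<theta> f J \<le> \<theta> f (I \<sqinter> J)"
      unfolding theta_eq[OF m, of J] inf_Sup_frame by (auto intro!: SUP_least simp: inf_commute)
  qed
  have Sup: "\<theta> f (\<Squnion>S) = \<Squnion>(\<theta> f ` S)" for S
  proof (rule order.antisym)
    show "\<Squnion>(\<theta> f ` S) \<le> \<theta> f (\<Squnion>S)" by (auto intro!: SUP_least theta_mono Sup_upper)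
    have "f a \<le> \<Squnion>(\<theta> f ` S)" if a: "a \<in> elts (\<Squnion>S)" for a
    proof -
      obtain F where F: "finite F" "F \<subseteq> (\<Union>I\<in>S. elts I)" "a \<le> \<Squnion>F"
        using a unfolding elts_Sup_eq by blast
      \<comment> \<open>Roundness supplies the enlarged joinands \<open>g x\<close> without leaving
        the union of the ideals.\<close>
      have "\<forall>x\<in>F. \<exists>y. y \<in> (\<Union>I\<in>S. elts I) \<and> x \<prec> y"
        using F(2) elts_round by blast
      then obtain g where g: "\<And>x. x \<in> F \<Longrightarrow> g x \<in> (\<Union>I\<in>S. elts I)" "\<And>x. x \<in> F \<Longrightarrow> x \<prec> g x"
        by metis
      have "f a \<le> f (\<Squnion>F)" using F(3) by (rule mono)
      also have "\<dots> \<le> \<Squnion>((\<lambda>x. f (g x)) ` F)"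
        using proximity_hom_Sup_le[OF f F(1), of "\<lambda>x. x" g] g(2) by simp
      also have "\<dots> \<le> \<Squnion>(\<theta> f ` S)"
      proof (rule SUP_least)
        fix x assume "x \<in> F"
        then obtain I where I: "I \<in> S" "g x \<in> elts I" using g(1) by blast
        have "f (g x) \<le> \<theta> f I" unfolding theta_eq[OF m] using I(2) by (rule SUP_upper)
        then show "f (g x) \<le> \<Squnion>(\<theta> f ` S)" by (rule SUP_upper2[OF I(1)])
      qed
      finally show ?thesis .
    qed
    then show "\<theta> f (\<Squnion>S) \<le> \<Squnion>(\<theta> f ` S)"
      unfolding theta_eq[OF m, of "\<Squnion>S"] by (rule SUP_least)
  qed
  show ?thesis unfolding frame_hom_def using top inf Sup by blast
qed

text \<open>With \<open>b\<close> in \<open>J\<close> bounding \<open>I\<close> through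
  \<open>\<kappa>\<close>, roundness of \<open>J\<close> yields \<open>c\<close> in \<open>J\<close>
  with \<open>b \<prec> c\<close>, and \<open>f b \<prec> f c\<close> separates the two
  values.\<close>

lemma theta_way_below:
  assumes f: "proximity_hom f" and "I \<lless> J"
  shows "\<theta> f I \<prec> \<theta> f J"
proof -
  note m = proximity_hom_meet[OF f]
  obtain b where b: "b \<in> elts J" "I \<le> \<kappa> b"
    using \<open>I \<lless> J\<close> way_below_round_ideal_iff by blast
  obtain c where c: "c \<in> elts J" "b \<prec> c" using elts_round[OF b(1)] by blast
  have "\<theta> f I \<le> f b"
    unfolding theta_eq[OF m]
  proof (rule SUP_least)
    fix a assume "a \<in> elts I"
    then have "a \<prec> b" using b(2) by (auto simp: less_eq_round_ideal_def elts_kappa)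
    then show "f a \<le> f b" by (intro meet_semilattice_hom_mono[OF m] prox_le)
  qed
  moreover have "f c \<le> \<theta> f J" unfolding theta_eq[OF m] using c(1) by (rule SUP_upper)
  ultimately show ?thesis using prox_trans proximity_hom_prox[OF f c(2)] by blast
qed

lemma frame_hom_sup:
  assumes "frame_hom \<psi>"
  shows "\<psi> (x \<squnion> y) = \<psi> x \<squnion> \<psi> y"
proof -
  have "\<psi> (\<Squnion>{x, y}) = \<Squnion>(\<psi> ` {x, y})" using assms unfolding frame_hom_def by blast
  then show ?thesis by simp
qed

lemma frame_hom_bot:
  assumes "frame_hom \<psi>"
  shows "\<psi> \<bottom> = \<bottom>"
proof -
  have "\<psi> (\<Squnion>{}) = \<Squnion>(\<psi> ` {})" using assms unfolding frame_hom_def by blast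
  then show ?thesis by simp
qed

text \<open>A frame homomorphism is determined by its values on the ideals
  \<open>\<kappa> b\<close>. The right-hand side has the shape of \<open>theta_eq\<close> for
  \<open>\<rho> \<phi>\<close>.\<close>

lemma frame_hom_round_ideal:
  assumes "frame_hom \<phi>"
  shows "\<phi> I = \<Squnion>(\<rho> \<phi> ` elts I)"
proof -
  have "\<phi> (\<Squnion>(\<kappa> ` elts I)) = \<Squnion>(\<phi> ` \<kappa> ` elts I)"
    using assms unfolding frame_hom_def by blast
  then show ?thesis
    unfolding round_ideal_eq_Sup_kappa[of I, symmetric] by (simp add: rho_def image_comp)
qed

lemma proximity_hom_rho:
  fixes \<phi> :: "'a::proximity_frame round_ideal \<Rightarrow> 'b::proximity_frame"
  assumes \<phi>: "frame_hom \<phi>" and wb: "\<And>I J. I \<lless> J \<Longrightarrow> \<phi> I \<prec> \<phi> J"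
  shows "proximity_hom (\<rho> \<phi>)"
  unfolding proximity_hom_def
proof (intro conjI allI impI)
  show "meet_semilattice_hom (\<rho> \<phi>)"
    using \<phi> by (simp add: meet_semilattice_hom_def frame_hom_def rho_def kappa_top kappa_inf)
  show "\<rho> \<phi> \<bottom> = \<bottom>" by (simp add: rho_def kappa_bot frame_hom_bot[OF \<phi>])
  show "\<rho> \<phi> a = \<Squnion>{\<rho> \<phi> b | b. b \<prec> a}" for a
    \<comment> \<open>At the ideal \<open>\<kappa> a\<close>, whose members are the
      \<open>b \<prec> a\<close>, the join formula becomes condition (3).\<close>
    using frame_hom_round_ideal[OF \<phi>, of "\<kappa> a"]
    by (simp add: elts_kappa image_Collect rho_def)
  fix a\<^sub>1 b\<^sub>1 a\<^sub>2 b\<^sub>2 :: 'a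
  assume "a\<^sub>1 \<prec> b\<^sub>1" "a\<^sub>2 \<prec> b\<^sub>2"
  \<comment> \<open>\<open>\<kappa>\<close> need not preserve binary joins, but
    \<open>a\<^sub>1 \<squnion> a\<^sub>2\<close> lies in the join of the two ideals and so
    witnesses the way-below relation that \<open>\<phi>\<close> turns into condition (2).\<close>
  then have "a\<^sub>1 \<squnion> a\<^sub>2 \<in> elts (\<kappa> b\<^sub>1 \<squnion> \<kappa> b\<^sub>2)"
    unfolding elts_sup_eq elts_kappa by blast
  then have "\<kappa> (a\<^sub>1 \<squnion> a\<^sub>2) \<lless> \<kappa> b\<^sub>1 \<squnion> \<kappa> b\<^sub>2"
    unfolding way_below_round_ideal_iff by blast
  then show "\<rho> \<phi> (a\<^sub>1 \<squnion> a\<^sub>2) \<prec> \<rho> \<phi> b\<^sub>1 \<squnion> \<rho> \<phi> b\<^sub>2"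
    using wb by (simp add: rho_def frame_hom_sup[OF \<phi>, symmetric])
qed

theorem theorem3p14:
  shows "\<theta> \<in> (PrFrm :: ('a::proximity_frame \<Rightarrow> 'b::proximity_frame) set)
              \<rightarrow> (C_hom :: ('a round_ideal \<Rightarrow> 'b) set) \<and>
         \<rho> \<in> (C_hom :: ('a round_ideal \<Rightarrow> 'b) set) \<rightarrow> (PrFrm :: ('a \<Rightarrow> 'b) set) \<and>
         (\<forall>\<phi> \<in> (C_hom :: ('a round_ideal \<Rightarrow> 'b) set). (\<theta> \<circ> \<rho>) \<phi> = \<phi>) \<and>
         (\<forall>f \<in> (PrFrm :: ('a \<Rightarrow> 'b) set). (\<rho> \<circ> \<theta>) f = f)"
proof (intro conjI ballI)
  show "\<theta> \<in> (PrFrm :: ('a \<Rightarrow> 'b) set) \<rightarrow> C_hom"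
    by (auto simp: PrFrm_def C_hom_def frame_hom_theta theta_way_below)
  show rho: "\<rho> \<in> (C_hom :: ('a round_ideal \<Rightarrow> 'b) set) \<rightarrow> PrFrm"
    by (auto simp: PrFrm_def C_hom_def intro: proximity_hom_rho)
  show "(\<theta> \<circ> \<rho>) \<phi> = \<phi>" if "\<phi> \<in> C_hom" for \<phi> :: "'a round_ideal \<Rightarrow> 'b"
  proof
    fix I
    \<comment> \<open>This makes \<open>theta_eq\<close> applicable to \<open>\<rho> \<phi>\<close>,
      so that both sides become the join of \<open>\<rho> \<phi>\<close> over
      \<open>I\<close>.\<close>
    have "meet_semilattice_hom (\<rho> \<phi>)"
      using rho that proximity_hom_meet by (auto simp: PrFrm_def)
    moreover have "frame_hom \<phi>" using that by (simp add: C_hom_def)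
    ultimately show "(\<theta> \<circ> \<rho>) \<phi> I = \<phi> I"
      using frame_hom_round_ideal[of \<phi> I] by (simp add: theta_eq)
  qed
  show "(\<rho> \<circ> \<theta>) f = f" if "f \<in> PrFrm" for f :: "'a \<Rightarrow> 'b"
  proof
    fix a
    have f: "proximity_hom f" using that by (simp add: PrFrm_def)
    have "\<theta> f (\<kappa> a) = \<Squnion>{f b | b. b \<prec> a}"
      by (simp add: theta_eq[OF proximity_hom_meet[OF f]] elts_kappa image_Collect)
    then show "(\<rho> \<circ> \<theta>) f a = f a"
      by (simp add: rho_def proximity_hom_approx[OF f, of a, symmetric])
  qed
qed

end
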